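(* Fix an integer $k\ge 1$. For every integer $n\ge 0$, the number of partitions of $n$ satisfying condition (P) equals the number of partitions of $n$ satisfying condition (S), where: (P) every part is either even or $\equiv 3 \pmod{2k+6}$. (S) all of the following hold: - the difference between adjacent parts is never $1$; - an even part $2j$ is never immediately adjacent to any of the $k$ odd numbers $2j-3,2j-5,\dots,2j-2k-1$; - (initial condition, implied by a fictitious zero) the smallest part is not $1$. Moreover, the generating function of the partitions satisfying (P) is the periodic infinite product $\prod_m (1-q^m)^{-1}$ over all $m\ge1$ with $m$ even or $m\equiv 3\pmod{2k+6}$; and a partition satisfies (S) if and only if its conjugate satisfies the following condition (C): (C) both of the following hold: - no part appears exactly once; - if a part appears exactly $3$, $5$, $\dots$, or $2k+1$ times, then there are an even number of parts strictly greater than it.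
   Context: Partitions $\lambda=(\lambda_1\ge\lambda_2\ge\dots\ge\lambda_r)$ have positive integer parts. Two parts are (immediately) adjacent if they are $\lambda_i,\lambda_{i+1}$ for some $1\le i<r$. The initial condition is "implied by a fictitious zero" if it is what the difference/adjacency conditions impose when one part equal to $0$ is appended to the partition. Numbers of parts are counted with multiplicity (zero is even). The conjugate of a partition is obtained by transposing its Ferrers diagram. *)

theory Defs
  imports "HOL-Analysis.Analysis" "HOL-Number_Theory.Cong"
    "HOL-Computational_Algebra.Formal_Power_Series"
begin

text \<open>A partition is the list of its parts in weakly decreasing order.\<close>

definition is_partition :: "nat list \<Rightarrow> bool" where
  "is_partition xs \<longleftrightarrow> sorted_wrt (\<ge>) xs \<and> (\<forall>x \<in> set xs. x > 0)"

definition partitions_of :: "nat \<Rightarrow> nat list set" where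
  "partitions_of n = {xs. is_partition xs \<and> sum_list xs = n}"

definition ferrers :: "nat list \<Rightarrow> (nat \<times> nat) set" where
  "ferrers xs = {(i, j). i < length xs \<and> j < xs ! i}"

text \<open>The parts of the conjugate are the column lengths of the Ferrers diagram;
  \<open>ferrers_conjugate\<close> below says that the diagram of the conjugate is the transposed diagram.\<close>

definition conjugate :: "nat list \<Rightarrow> nat list" where
  "conjugate xs = map (\<lambda>j. card {i. (i, j) \<in> ferrers xs}) [0..<card {j. (0, j) \<in> ferrers xs}]"

definition adjacent :: "nat list \<Rightarrow> nat \<Rightarrow> nat \<Rightarrow> bool" where
  "adjacent xs a b \<longleftrightarrow> (\<exists>i. Suc i < length xs \<and>
     (a = xs ! i \<and> b = xs ! Suc i \<or> a = xs ! Suc i \<and> b = xs ! i))"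

definition allowed_part :: "nat \<Rightarrow> nat \<Rightarrow> bool" where
  "allowed_part k m \<longleftrightarrow> even m \<or> [m = 3] (mod (2 * k + 6))"

definition cond_P :: "nat \<Rightarrow> nat list \<Rightarrow> bool" where
  "cond_P k xs \<longleftrightarrow> (\<forall>x \<in> set xs. allowed_part k x)"

text \<open>The numbers \<open>2j - 3, 2j - 5, \<dots>, 2j - 2k - 1\<close> are formed in the integers, so that
  nonpositive ones (which are never parts) impose nothing.\<close>

definition diff_conds :: "nat \<Rightarrow> nat list \<Rightarrow> bool" where
  "diff_conds k xs \<longleftrightarrow>
     (\<forall>a b. adjacent xs a b \<longrightarrow> \<bar>int a - int b\<bar> \<noteq> 1) \<and>
     (\<forall>j b. adjacent xs (2 * j) b \<longrightarrow> int b \<notin> {2 * int j - (2 * int t + 1) | t. t \<in> {1..k}})"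

definition cond_S :: "nat \<Rightarrow> nat list \<Rightarrow> bool" where
  "cond_S k xs \<longleftrightarrow> diff_conds k xs \<and> (xs \<noteq> [] \<longrightarrow> Min (set xs) \<noteq> 1)"

definition cond_C :: "nat \<Rightarrow> nat list \<Rightarrow> bool" where
  "cond_C k xs \<longleftrightarrow>
     (\<forall>x \<in> set xs. count_list xs x \<noteq> 1) \<and>
     (\<forall>x \<in> set xs. count_list xs x \<in> {2 * t + 1 | t. t \<in> {1..k}} \<longrightarrow>
        even (length (filter (\<lambda>y. y > x) xs)))"

lemma partition_nth_mono:
  assumes "is_partition xs" "i \<le> j" "j < length xs"
  shows "xs ! j \<le> xs ! i"
  using assms unfolding is_partition_def by (cases "i = j") (auto simp: sorted_wrt_iff_nth_less)

lemma finite_partitions_of: "finite (partitions_of n)"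
proof (rule finite_subset)
  show "partitions_of n \<subseteq> {xs. set xs \<subseteq> {..n} \<and> length xs \<le> n}"
  proof
    fix xs assume xs: "xs \<in> partitions_of n"
    have "length xs \<le> sum_list xs" if "\<forall>x \<in> set xs. x > 0" for xs :: "nat list"
      using that by (induction xs) auto
    then show "xs \<in> {xs. set xs \<subseteq> {..n} \<and> length xs \<le> n}"
      using xs by (auto simp: partitions_of_def is_partition_def member_le_sum_list)
  qed
qed (simp add: finite_lists_length_le)

lemma ferrers_column:
  assumes "is_partition xs"
  shows "{i. (i, j) \<in> ferrers xs} = {..<card {i. (i, j) \<in> ferrers xs}}"
proof -
  let ?A = "{i. (i, j) \<in> ferrers xs}"
  have fin: "finite ?A"
    by (rule finite_subset[of _ "{..<length xs}"]) (auto simp: ferrers_def)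
  have down: "i \<in> ?A" if "i' \<in> ?A" "i \<le> i'" for i i'
    using that partition_nth_mono[OF assms, of i i'] by (auto simp: ferrers_def)
  show ?thesis
  proof (cases "?A = {}")
    case True
    then show ?thesis by simp
  next
    case False
    have "?A = {..Max ?A}"
      using False fin down by (auto intro: Max_ge dest: Max_in)
    then show ?thesis
      by (metis card_atMost lessThan_Suc_atMost)
  qed
qed

lemma ferrers_conjugate:
  assumes "is_partition xs"
  shows "ferrers (conjugate xs) = (ferrers xs)\<inverse>"
proof -
  let ?w = "card {j. (0, j) \<in> ferrers xs}"
  have w: "?w = (if xs = [] then 0 else xs ! 0)"
    by (auto simp: ferrers_def)
  have "(j, i) \<in> ferrers (conjugate xs) \<longleftrightarrow> (i, j) \<in> ferrers xs" for i j
  proof -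
    have "(j, i) \<in> ferrers (conjugate xs) \<longleftrightarrow> j < ?w \<and> i < card {i. (i, j) \<in> ferrers xs}"
    proof -
      have "length (conjugate xs) = ?w"
        by (simp add: conjugate_def)
      moreover have "conjugate xs ! j = card {i. (i, j) \<in> ferrers xs}" if "j < ?w"
        using that by (simp add: conjugate_def)
      moreover have "(j, i) \<in> ferrers (conjugate xs) \<longleftrightarrow>
          j < length (conjugate xs) \<and> i < conjugate xs ! j"
        by (simp add: ferrers_def)
      ultimately show ?thesis by auto
    qed
    also have "\<dots> \<longleftrightarrow> j < ?w \<and> (i, j) \<in> ferrers xs"
      using ferrers_column[OF assms, of j] by blast
    also have "\<dots> \<longleftrightarrow> (i, j) \<in> ferrers xs"
      using partition_nth_mono[OF assms, of 0 i] unfolding w by (auto simp: ferrers_def)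
    finally show ?thesis .
  qed
  then show ?thesis by auto
qed

lemma is_partition_conjugate:
  assumes "is_partition xs"
  shows "is_partition (conjugate xs)"
proof -
  have fin: "finite {i. (i, j) \<in> ferrers xs}" for j
    by (rule finite_subset[of _ "{..<length xs}"]) (auto simp: ferrers_def)
  have "card {i. (i, j') \<in> ferrers xs} \<le> card {i. (i, j) \<in> ferrers xs}" if "j \<le> j'" for j j'
    using that by (intro card_mono fin) (auto simp: ferrers_def)
  moreover have "card {i. (i, j) \<in> ferrers xs} > 0" if "j < card {j. (0, j) \<in> ferrers xs}" for j
  proof -
    have "(0, j) \<in> ferrers xs"
      using that by (cases "xs = []") (auto simp: ferrers_def)
    then show ?thesis
      using fin[of j] by (auto simp: card_gt_0_iff)
  qed
  ultimately show ?thesis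
    by (auto simp: is_partition_def conjugate_def sorted_wrt_iff_nth_less)
qed

text \<open>The initial condition in \<open>cond_S\<close> is the one implied by a fictitious zero.\<close>

lemma cond_S_iff_fictitious_zero:
  assumes "is_partition xs"
  shows "cond_S k xs \<longleftrightarrow> diff_conds k (xs @ [0])"
proof (cases "xs = []")
  case True
  then show ?thesis by (auto simp: cond_S_def diff_conds_def adjacent_def)
next
  case False
  have "Min (set xs) = last xs"
  proof (rule Min_eqI)
    show "last xs \<le> y" if "y \<in> set xs" for y
      using that False partition_nth_mono[OF assms, of _ "length xs - 1"]
      by (auto simp: in_set_conv_nth last_conv_nth)
  qed (use False in auto)
  moreover have adj: "adjacent (xs @ [0]) a b \<longleftrightarrow>
      adjacent xs a b \<or> a = last xs \<and> b = 0 \<or> a = 0 \<and> b = last xs" for a b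
  proof -
    have "(\<exists>i. Suc i < length (xs @ [0]) \<and> Q i) \<longleftrightarrow>
        (\<exists>i. Suc i < length xs \<and> Q i) \<or> Q (length xs - 1)" for Q
      using False by (auto simp: less_Suc_eq) (metis Suc_pred diff_Suc_1 length_greater_0_conv)+
    then have "adjacent (xs @ [0]) a b \<longleftrightarrow>
      (\<exists>i. Suc i < length xs \<and>
       (a = (xs @ [0]) ! i \<and> b = (xs @ [0]) ! Suc i \<or> a = (xs @ [0]) ! Suc i \<and> b = (xs @ [0]) ! i)) \<or>
       (a = last xs \<and> b = 0 \<or> a = 0 \<and> b = last xs)"
      using False unfolding adjacent_def by (simp add: nth_append last_conv_nth)
    then show ?thesis
      unfolding adjacent_def by (auto simp: nth_append)
  qed
  moreover have "int 0 \<notin> {2 * int j - (2 * int t + 1) | t. t \<in> {1..k}}" for j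
    by auto presburger
  moreover have "int b \<notin> {2 * int 0 - (2 * int t + 1) | t. t \<in> {1..k}}" for b
    by auto
  ultimately show ?thesis
    unfolding cond_S_def diff_conds_def using False by (auto 0 3)
qed

end

theory Submission
  imports Defs
begin

text \<open>
  Write a partition satisfying (S) as the sequence of its successive differences, the fictitious
  zero included. Only the parity of a part matters for the condition on the difference above it: an
  even difference is always permitted, and an odd difference \<open>d\<close> is permitted above an even
  part iff \<open>d \<ge> 3\<close>, above an odd part iff \<open>d \<ge> 2 k + 3\<close> (\<open>gap\<close>, \<open>gap_iff\<close>). The difference
  below the \<open>i\<close>-th largest part is the multiplicity of \<open>i\<close> in the conjugate, and the next part counts
  the parts of the conjugate exceeding \<open>i\<close>; so (C) is the same condition, which settles the last claim.

  For the count, subtracting 2 from the \<open>i\<close> largest parts reduces every difference to \<open>0\<close>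
  or to the least permitted odd value, at the price of a factor \<open>1 / (1 - q^(2 i))\<close> for each \<open>i\<close>.
  These factors account for the even parts in (P). What remains is the choice of the indices
  \<open>i\<^sub>1 > i\<^sub>2 > \<dots>\<close> of the odd differences. With \<open>A = q^3\<close> and \<open>B = q^(2 k + 3)\<close> it has the weight
  \<open>A^i\<^sub>1 B^i\<^sub>2 A^i\<^sub>3 \<dots>\<close>, since odd differences alternate between the two kinds of base. Put
  \<open>Q = A B = q^(2 k + 6)\<close>. Summing over the sequences of lengths \<open>2 t\<close> and \<open>2 t + 1\<close> gives
  \<open>A^t Q^(t^2) / ((Q; Q)\<^sub>t (A; Q)\<^sub>t\<^sub>+\<^sub>1)\<close>, and by Cauchy's identity the sum over \<open>t\<close> is the product of
  \<open>1 / (1 - A Q^j)\<close> over \<open>j \<ge> 0\<close>, which accounts for the parts \<open>3 + (2 k + 6) j\<close> in (P).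

  The steps are \<open>card_gap_chains_Suc\<close> (removal of the even factors),
  \<open>alternating_recurrence_cauchy_sum\<close> (summation by length) and \<open>cauchy_identity_truncated\<close>.
  The series identities are stated for finite sums and products modulo \<open>X^T\<close>, as divisibility of the
  difference of the two sides by \<open>X^T\<close>.
\<close>

section \<open>Permitted differences, and conjugation\<close>

text \<open>The least odd difference that (S) permits above a part \<open>b\<close>. An odd difference above an odd \<open>b\<close>
  leads to an even part, which excludes \<open>3, 5, \<dots>, 2 k + 1\<close> as well.\<close>

definition odd_gap :: "nat \<Rightarrow> nat \<Rightarrow> nat" where
  "odd_gap k b = (if even b then 3 else 2 * k + 3)"

definition gap :: "nat \<Rightarrow> nat \<Rightarrow> nat \<Rightarrow> bool" where
  "gap k y x \<longleftrightarrow> y \<le> x \<and> (even (x - y) \<or> odd_gap k y \<le> x - y)"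

lemma gap_iff:
  "gap k y x \<longleftrightarrow> y \<le> x \<and> x - y \<noteq> 1 \<and> (even x \<longrightarrow> (\<forall>t\<in>{1..k}. x - y \<noteq> 2 * t + 1))"
proof (cases "y \<le> x \<and> odd (x - y)")
  case True
  then obtain t where t: "x = y + 2 * t + 1"
    by (metis add.assoc le_add_diff_inverse oddE)
  show ?thesis
    by (auto simp: gap_def odd_gap_def t)
next
  case False
  have "d \<noteq> 1" "d \<noteq> 2 * t + 1" if "even d" for d t :: nat
    using that by auto
  with False show ?thesis
    unfolding gap_def by blast
qed

text \<open>In a weakly decreasing list the larger of two adjacent parts comes first, and
  \<open>2 j - 3, 2 j - 5, \<dots>\<close> are all smaller than \<open>2 j\<close>; so the symmetric adjacency conditions constrain
  each part only through its successor.\<close>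

lemma cond_S_iff_gaps:
  assumes "is_partition xs"
  shows "cond_S k xs \<longleftrightarrow> (\<forall>i<length xs. gap k ((xs @ [0]) ! Suc i) (xs ! i))"
proof -
  let ?ys = "xs @ [0]"
  have dec: "?ys ! Suc i \<le> ?ys ! i" if "i < length xs" for i
    using that partition_nth_mono[OF assms, of i "Suc i"] by (auto simp: nth_append)
  have "diff_conds k ?ys \<longleftrightarrow> (\<forall>i<length xs. gap k (?ys ! Suc i) (?ys ! i))" (is "?L \<longleftrightarrow> ?R")
  proof
    assume L: ?L
    show ?R
    proof (intro allI impI)
      fix i assume i: "i < length xs"
      have adj: "adjacent ?ys (?ys ! i) (?ys ! Suc i)"
        unfolding adjacent_def using i by auto
      have "\<bar>int (?ys ! i) - int (?ys ! Suc i)\<bar> \<noteq> 1"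
        using L adj unfolding diff_conds_def by blast
      moreover have "?ys ! i - ?ys ! Suc i \<noteq> 2 * t + 1" if "even (?ys ! i)" "t \<in> {1..k}" for t
      proof
        assume d: "?ys ! i - ?ys ! Suc i = 2 * t + 1"
        from that(1) obtain j where j: "?ys ! i = 2 * j" by (elim evenE)
        have "int (?ys ! Suc i) \<notin> {2 * int j - (2 * int t + 1) | t. t \<in> {1..k}}"
          using L adj unfolding diff_conds_def j by blast
        moreover have "int (?ys ! Suc i) = 2 * int j - (2 * int t + 1)"
          using d j by simp
        ultimately show False using that(2) by blast
      qed
      ultimately show "gap k (?ys ! Suc i) (?ys ! i)"
        using dec[OF i] unfolding gap_iff by auto
    qed
  next
    assume R: ?R
    show ?L
      unfolding diff_conds_def
    proof (intro conjI allI impI)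
      fix a b assume "adjacent ?ys a b"
      then obtain i where i: "i < length xs" "a = ?ys ! i \<and> b = ?ys ! Suc i \<or> a = ?ys ! Suc i \<and> b = ?ys ! i"
        unfolding adjacent_def by auto
      have "gap k (?ys ! Suc i) (?ys ! i)" using R i(1) by blast
      then show "\<bar>int a - int b\<bar> \<noteq> 1"
        using i(2) unfolding gap_iff by auto
    next
      fix j b assume "adjacent ?ys (2 * j) b"
      then obtain i where i: "i < length xs" "2 * j = ?ys ! i \<and> b = ?ys ! Suc i \<or> 2 * j = ?ys ! Suc i \<and> b = ?ys ! i"
        unfolding adjacent_def by auto
      have g: "gap k (?ys ! Suc i) (?ys ! i)" using R i(1) by blast
      show "int b \<notin> {2 * int j - (2 * int t + 1) | t. t \<in> {1..k}}"
      proof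
        assume "int b \<in> {2 * int j - (2 * int t + 1) | t. t \<in> {1..k}}"
        then obtain t where "t \<in> {1..k}" "int b = 2 * int j - (2 * int t + 1)" by blast
        then have t: "t \<in> {1..k}" "2 * j = b + (2 * t + 1)" by linarith+
        with i(2) dec[OF i(1)] have jb: "2 * j = ?ys ! i" "b = ?ys ! Suc i" by auto
        have "even (?ys ! i)"
          unfolding jb(1)[symmetric] by simp
        moreover have "?ys ! i - ?ys ! Suc i = 2 * t + 1"
          using t(2) jb by linarith
        ultimately show False
          using g t(1) unfolding gap_iff by blast
      qed
    qed
  qed
  moreover have "?ys ! i = xs ! i" if "i < length xs" for i
    using that by (simp add: nth_append)
  ultimately show ?thesis
    unfolding cond_S_iff_fictitious_zero[OF assms] by auto
qed

text \<open>The columns longer than \<open>i\<close> are those that meet row \<open>i\<close> (rows being numbered from 0).\<close>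

lemma length_filter_conjugate:
  assumes "is_partition xs" "i \<le> length xs"
  shows "length (filter (\<lambda>y. i < y) (conjugate xs)) = (xs @ [0]) ! i"
proof -
  let ?h = "\<lambda>j. card {i. (i, j) \<in> ferrers xs}"
  let ?w = "card {j. (0, j) \<in> ferrers xs}"
  have w: "?w = (if xs = [] then 0 else xs ! 0)"
    by (auto simp: ferrers_def)
  have h: "i < ?h j \<longleftrightarrow> (i, j) \<in> ferrers xs" for j
    using ferrers_column[OF assms(1), of j] by blast
  have "length (filter (\<lambda>y. i < y) (conjugate xs)) = card {j. j < ?w \<and> i < ?h j}"
    by (simp add: conjugate_def filter_map comp_def length_filter_conv_card del: upt_Suc)
      (rule arg_cong[of _ _ card], auto)
  also have "{j. j < ?w \<and> i < ?h j} = {..<(xs @ [0]) ! i}"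
    using assms(2) partition_nth_mono[OF assms(1), of 0 i] unfolding h w
    by (auto simp: ferrers_def nth_append)
  finally show ?thesis by simp
qed

lemma count_list_conjugate:
  assumes "is_partition xs" "i < length xs"
  shows "count_list (conjugate xs) (Suc i) = xs ! i - (xs @ [0]) ! Suc i"
proof -
  have "length (filter (\<lambda>y. i < y) ys) = count_list ys (Suc i) + length (filter (\<lambda>y. Suc i < y) ys)" for ys
    by (induction ys) auto
  from this[of "conjugate xs"] show ?thesis
    using length_filter_conjugate[OF assms(1), of i] length_filter_conjugate[OF assms(1), of "Suc i"] assms(2)
    by (simp add: nth_append)
qed

lemma conjugate_parts:
  assumes "is_partition xs" "x \<in> set (conjugate xs)"
  obtains i where "x = Suc i" "i < length xs"
proof -
  have "x > 0"
    using is_partition_conjugate[OF assms(1)] assms(2) by (auto simp: is_partition_def)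
  moreover have "filter (\<lambda>y. length xs < y) (conjugate xs) = []"
    using length_filter_conjugate[OF assms(1), of "length xs"] by simp
  then have "x \<le> length xs"
    using assms(2) by (auto simp: filter_empty_conv)
  ultimately show ?thesis
    using that[of "x - 1"] by auto
qed

text \<open>A multiplicity in the conjugate is a difference \<open>x - y\<close> of successive parts, and the number of
  larger parts is \<open>y\<close>. When the difference is odd, \<open>y\<close> is even iff \<open>x\<close> is odd, so (C) and (S) forbid
  the same odd differences.\<close>

lemma cond_C_conjugate_iff_gaps:
  assumes "is_partition xs"
  shows "cond_C k (conjugate xs) \<longleftrightarrow> (\<forall>i<length xs. gap k ((xs @ [0]) ! Suc i) (xs ! i))"
proof -
  let ?ys = "xs @ [0]"
  define Q where "Q c g \<longleftrightarrow> c \<noteq> 1 \<and> (c \<in> {2 * t + 1 | t. t \<in> {1..k}} \<longrightarrow> even g)" for c g :: nat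
  have Q: "Q (xs ! i - ?ys ! Suc i) (?ys ! Suc i) \<longleftrightarrow> gap k (?ys ! Suc i) (xs ! i)" if "i < length xs" for i
  proof -
    have le: "?ys ! Suc i \<le> xs ! i"
      using that partition_nth_mono[OF assms, of i "Suc i"] by (auto simp: nth_append)
    have "even (?ys ! Suc i) \<longleftrightarrow> odd (xs ! i)" if "xs ! i - ?ys ! Suc i = 2 * t + 1" for t
      using that le by presburger
    then show ?thesis
      unfolding Q_def gap_iff using le by blast
  qed
  have "cond_C k (conjugate xs) \<longleftrightarrow>
    (\<forall>x\<in>set (conjugate xs). Q (count_list (conjugate xs) x) (length (filter (\<lambda>y. x < y) (conjugate xs))))"
    unfolding cond_C_def Q_def by blast
  also have "\<dots> \<longleftrightarrow> (\<forall>i<length xs. Q (count_list (conjugate xs) (Suc i))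
      (length (filter (\<lambda>y. Suc i < y) (conjugate xs))))" (is "?L \<longleftrightarrow> ?R")
  proof
    assume ?R
    then show ?L using conjugate_parts[OF assms] by metis
  next
    assume L: ?L
    show ?R
    proof (intro allI impI)
      fix i assume "i < length xs"
      show "Q (count_list (conjugate xs) (Suc i)) (length (filter (\<lambda>y. Suc i < y) (conjugate xs)))"
      proof (cases "Suc i \<in> set (conjugate xs)")
        case False
        then have "count_list (conjugate xs) (Suc i) = 0" by simp
        then show ?thesis unfolding Q_def by auto
      qed (use L in blast)
    qed
  qed
  also have "\<dots> \<longleftrightarrow> (\<forall>i<length xs. gap k (?ys ! Suc i) (xs ! i))"
    using Q count_list_conjugate[OF assms] length_filter_conjugate[OF assms] by (simp add: Suc_le_eq)
  finally show ?thesis .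
qed

section \<open>Counting chains of parts with permitted differences\<close>

text \<open>Partitions satisfying (S) are read from the smallest part upwards, starting above a base \<open>b\<close>.
  Only the excess over the base is counted in the weight \<open>w\<close>, which makes the count depend on \<open>b\<close>
  through its parity alone (\<open>card_gap_chains_cong_parity\<close>). The length is fixed; shorter partitions
  are padded with zeros (\<open>card_cond_S\<close>).\<close>

definition gap_chains :: "nat \<Rightarrow> nat \<Rightarrow> nat \<Rightarrow> nat \<Rightarrow> nat list set" where
  "gap_chains k b l w = {ys. length ys = l \<and> successively (gap k) (b # ys) \<and> sum_list ys = w + l * b}"

lemma gap_chain_sorted:
  assumes "successively (gap k) ys"
  shows "sorted ys"
proof -
  have "successively (\<le>) ys"
    using assms by (rule successively_mono) (auto simp: gap_def)
  then show ?thesis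
    by (simp add: successively_conv_sorted_wrt)
qed

lemma finite_gap_chains: "finite (gap_chains k b l w)"
proof (rule finite_subset)
  show "gap_chains k b l w \<subseteq> {ys. set ys \<subseteq> {..w + l * b} \<and> length ys = l}"
    unfolding gap_chains_def using member_le_sum_list by fastforce
qed (simp add: finite_lists_length_eq)

text \<open>The first of \<open>l + 1\<close> differences raises all \<open>l + 1\<close> entries, hence contributes \<open>d * (l + 1)\<close> to the
  weight; the rest is a chain above the new base.\<close>

lemma Cons_in_gap_chains:
  "(b + d) # zs \<in> gap_chains k b (Suc l) w \<longleftrightarrow>
     (even d \<or> odd_gap k b \<le> d) \<and> d * Suc l \<le> w \<and> zs \<in> gap_chains k (b + d) l (w - d * Suc l)"
proof (cases "length zs = l \<and> successively (gap k) ((b + d) # zs)")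
  case True
  then have "\<forall>z\<in>set zs. b + d \<le> z"
    using gap_chain_sorted by fastforce
  then have "l * (b + d) \<le> sum_list zs"
    using True sum_list_mono[of zs "\<lambda>_. b + d" "\<lambda>x. x"] by (simp add: sum_list_triv)
  then have "sum_list ((b + d) # zs) = w + Suc l * b \<longleftrightarrow>
      d * Suc l \<le> w \<and> sum_list zs = w - d * Suc l + l * (b + d)"
    by (auto simp: algebra_simps)
  with True show ?thesis
    by (auto simp: gap_chains_def gap_def)
qed (auto simp: gap_chains_def)

lemma gap_add_2: "gap k (y + 2) (x + 2) \<longleftrightarrow> gap k y x"
  by (auto simp: gap_def odd_gap_def)

lemma map_add_2_in_gap_chains:
  "map (\<lambda>x. x + 2) ys \<in> gap_chains k (b + 2) l w \<longleftrightarrow> ys \<in> gap_chains k b l w"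
proof -
  have "successively (gap k) ((b + 2) # map (\<lambda>x. x + 2) ys) \<longleftrightarrow>
      successively (gap k) (map (\<lambda>x. x + 2) (b # ys))"
    by simp
  also have "\<dots> \<longleftrightarrow> successively (gap k) (b # ys)"
    unfolding successively_map gap_add_2 ..
  finally have "successively (gap k) ((b + 2) # map (\<lambda>x. x + 2) ys) \<longleftrightarrow> successively (gap k) (b # ys)" .
  moreover have "(\<Sum>x\<leftarrow>ys. x + 2) = sum_list ys + 2 * length ys"
    by (induction ys) auto
  ultimately show ?thesis
    unfolding gap_chains_def by (auto simp: algebra_simps)
qed

lemma gap_chains_add_2: "gap_chains k (b + 2) l w = map (\<lambda>x. x + 2) ` gap_chains k b l w"
proof (intro equalityI subsetI)
  fix ys assume ys: "ys \<in> gap_chains k (b + 2) l w"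
  then have "\<forall>y\<in>set ys. b + 2 \<le> y"
    using gap_chain_sorted unfolding gap_chains_def by fastforce
  then have "map (\<lambda>x. x + 2) (map (\<lambda>x. x - 2) ys) = ys"
    by (auto intro!: map_idI)
  then show "ys \<in> map (\<lambda>x. x + 2) ` gap_chains k b l w"
    using ys map_add_2_in_gap_chains by (metis imageI)
qed (auto simp: map_add_2_in_gap_chains[simplified])

lemma card_gap_chains_add_even: "card (gap_chains k (b + 2 * j) l w) = card (gap_chains k b l w)"
proof (induction j)
  case (Suc j)
  have "card (gap_chains k (b + 2 * j + 2) l w) = card (gap_chains k (b + 2 * j) l w)"
    unfolding gap_chains_add_2 by (rule card_image) (auto simp: inj_on_def)
  with Suc show ?case by (simp add: ac_simps)
qed simp

lemma card_gap_chains_cong_parity: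
  assumes "even b \<longleftrightarrow> even b'"
  shows "card (gap_chains k b l w) = card (gap_chains k b' l w)"
proof -
  have "card (gap_chains k b l w) = card (gap_chains k (b mod 2) l w)" for b
    using card_gap_chains_add_even[of k "b mod 2" "b div 2"] by simp
  with assms show ?thesis
    by (metis parity_cases even_iff_mod_2_eq_zero odd_iff_mod_2_eq_one)
qed

lemma gap_chains_0: "gap_chains k b 0 w = (if w = 0 then {[]} else {})"
  by (auto simp: gap_chains_def)

text \<open>The first difference is \<open>0\<close>, or the least permitted odd value, or else subtracting 2 from it leaves
  a permitted difference.\<close>

lemma card_gap_chains_Suc:
  "card (gap_chains k b (Suc l) w) = card (gap_chains k b l w)
     + (if odd_gap k b * Suc l \<le> w then card (gap_chains k (Suc b) l (w - odd_gap k b * Suc l)) else 0)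
     + (if 2 * Suc l \<le> w then card (gap_chains k b (Suc l) (w - 2 * Suc l)) else 0)"
proof -
  let ?c = "odd_gap k b"
  \<comment> \<open>First difference \<open>0\<close>, the least odd one, and all others, in this order.\<close>
  define X where "X = (#) b ` gap_chains k b l w"
  define Y where "Y = (if ?c * Suc l \<le> w then (#) (b + ?c) ` gap_chains k (b + ?c) l (w - ?c * Suc l) else {})"
  define Z where "Z = (if 2 * Suc l \<le> w then map (\<lambda>x. x + 2) ` gap_chains k b (Suc l) (w - 2 * Suc l) else {})"
  have c: "odd ?c" by (auto simp: odd_gap_def)
  have step: "(b + (d + 2)) # zs \<in> Z"
    if "even d \<or> ?c \<le> d" "(b + (d + 2)) # zs \<in> gap_chains k b (Suc l) w" for d zs
  proof -
    from that(2) have le: "(d + 2) * Suc l \<le> w"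
      and zs: "zs \<in> gap_chains k ((b + d) + 2) l (w - (d + 2) * Suc l)"
      unfolding Cons_in_gap_chains by (auto simp: ac_simps)
    from zs obtain us where us: "zs = map (\<lambda>x. x + 2) us" "us \<in> gap_chains k (b + d) l (w - (d + 2) * Suc l)"
      unfolding gap_chains_add_2 by blast
    have "(b + d) # us \<in> gap_chains k b (Suc l) (w - 2 * Suc l)"
    proof -
      have "d * Suc l \<le> w - 2 * Suc l" "w - 2 * Suc l - d * Suc l = w - (d + 2) * Suc l"
        using le by (simp_all add: algebra_simps)
      then show ?thesis
        unfolding Cons_in_gap_chains using that(1) us(2) by simp
    qed
    moreover have "2 * Suc l \<le> w" using le by simp
    ultimately have "map (\<lambda>x. x + 2) ((b + d) # us) \<in> Z"
      unfolding Z_def by (simp only: if_True imageI)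
    then show ?thesis using us(1) by simp
  qed
  have Z: "\<exists>d zs. ys = (b + (d + 2)) # zs \<and> (even d \<or> ?c \<le> d) \<and> ys \<in> gap_chains k b (Suc l) w" if "ys \<in> Z" for ys
  proof -
    from that obtain us where us: "2 * Suc l \<le> w" "us \<in> gap_chains k b (Suc l) (w - 2 * Suc l)"
      "ys = map (\<lambda>x. x + 2) us"
      unfolding Z_def by (auto split: if_splits)
    from us(2) obtain u vs where "us = u # vs" "b \<le> u"
      unfolding gap_chains_def by (cases us) (auto simp: gap_def)
    then obtain d where d: "us = (b + d) # vs"
      using le_Suc_ex by blast
    have vs: "even d \<or> ?c \<le> d" "d * Suc l \<le> w - 2 * Suc l" "vs \<in> gap_chains k (b + d) l (w - 2 * Suc l - d * Suc l)"
      using us(2) unfolding d Cons_in_gap_chains by auto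
    have "w - 2 * Suc l - d * Suc l = w - (d + 2) * Suc l" by (simp add: algebra_simps)
    with vs(3) have "map (\<lambda>x. x + 2) vs \<in> gap_chains k (b + d + 2) l (w - (d + 2) * Suc l)"
      unfolding gap_chains_add_2 by (metis imageI)
    moreover have "(d + 2) * Suc l \<le> w" using vs(2) us(1) by (simp add: algebra_simps)
    ultimately have "(b + (d + 2)) # map (\<lambda>x. x + 2) vs \<in> gap_chains k b (Suc l) w"
      unfolding Cons_in_gap_chains using vs(1) by (auto simp: add.assoc)
    with us(3) d vs(1) show ?thesis by auto
  qed
  have "gap_chains k b (Suc l) w = X \<union> Y \<union> Z"
  proof (intro equalityI subsetI)
    fix ys assume ys: "ys \<in> gap_chains k b (Suc l) w"
    then obtain y zs where "ys = y # zs" "b \<le> y"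
      unfolding gap_chains_def by (cases ys) (auto simp: gap_def)
    then obtain d where d: "ys = (b + d) # zs"
      using le_Suc_ex by blast
    note * = ys[unfolded d Cons_in_gap_chains]
    consider "d = 0" | "d = ?c" | "d \<ge> 2" "even (d - 2) \<or> ?c \<le> d - 2"
    proof -
      have "d \<ge> 2 \<and> (even (d - 2) \<or> ?c \<le> d - 2)" if "d \<noteq> 0" "d \<noteq> ?c"
      proof (cases "even d")
        case True
        with that(1) show ?thesis by presburger
      next
        case False
        with * have "?c \<le> d" by blast
        with False c that(2) have "?c + 2 \<le> d" by presburger
        then show ?thesis by linarith
      qed
      then show ?thesis using that by blast
    qed
    then show "ys \<in> X \<union> Y \<union> Z"
    proof cases
      case 1
      then show ?thesis using * unfolding d X_def by auto
    next
      case 2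
      then show ?thesis using * unfolding d Y_def by auto
    next
      case 3
      then have "d - 2 + 2 = d" by simp
      with step[OF 3(2), of zs] ys have "ys \<in> Z" unfolding d by (simp only:)
      then show ?thesis by blast
    qed
  next
    fix ys assume "ys \<in> X \<union> Y \<union> Z"
    moreover have "ys \<in> gap_chains k b (Suc l) w" if "ys \<in> X"
      using that Cons_in_gap_chains[of b 0] unfolding X_def by auto
    moreover have "ys \<in> gap_chains k b (Suc l) w" if "ys \<in> Y"
      using that Cons_in_gap_chains[of b ?c] unfolding Y_def by (auto split: if_splits)
    ultimately show "ys \<in> gap_chains k b (Suc l) w"
      using Z by blast
  qed
  moreover have "X \<inter> Y = {}"
    using c unfolding X_def Y_def by (auto simp: odd_gap_def split: if_splits)
  moreover have "(X \<union> Y) \<inter> Z = {}"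
  proof -
    have "ys \<notin> X \<union> Y" if "ys \<in> Z" for ys
    proof -
      from Z[OF that] obtain d zs where d: "ys = (b + (d + 2)) # zs" "even d \<or> ?c \<le> d"
        by blast
      then have "d + 2 \<noteq> ?c" using c by presburger
      then show ?thesis unfolding X_def Y_def d(1) by (auto split: if_splits)
    qed
    then show ?thesis by blast
  qed
  moreover have "finite X" "finite Y" "finite Z"
    unfolding X_def Y_def Z_def using finite_gap_chains by auto
  ultimately have "card (gap_chains k b (Suc l) w) = card X + card Y + card Z"
    by (simp add: card_Un_disjoint)
  moreover have "card X = card (gap_chains k b l w)"
    unfolding X_def by (rule card_image) auto
  moreover have "card Y = (if ?c * Suc l \<le> w then card (gap_chains k (Suc b) l (w - ?c * Suc l)) else 0)"
  proof -
    have "card (gap_chains k (b + ?c) l v) = card (gap_chains k (Suc b) l v)" for v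
      using c by (intro card_gap_chains_cong_parity) auto
    then show ?thesis unfolding Y_def by (auto simp: card_image)
  qed
  moreover have "card Z = (if 2 * Suc l \<le> w then card (gap_chains k b (Suc l) (w - 2 * Suc l)) else 0)"
    unfolding Z_def by (auto intro!: card_image simp: inj_on_def)
  ultimately show ?thesis by simp
qed

lemma cond_S_iff_chain:
  assumes "is_partition xs"
  shows "cond_S k xs \<longleftrightarrow> successively (gap k) (0 # rev xs)"
proof -
  have "0 # rev xs = rev (xs @ [0])" by simp
  then have "successively (gap k) (0 # rev xs) \<longleftrightarrow> successively (\<lambda>x y. gap k y x) (xs @ [0])"
    by (metis successively_rev)
  also have "\<dots> \<longleftrightarrow> (\<forall>i<length xs. gap k ((xs @ [0]) ! Suc i) (xs ! i))"
    by (auto simp: successively_conv_nth nth_append)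
  finally show ?thesis using cond_S_iff_gaps[OF assms] by simp
qed

lemma length_le_sum_list:
  assumes "\<forall>x\<in>set xs. x > 0"
  shows "length xs \<le> sum_list xs"
  using assms by (induction xs) (auto simp: Suc_le_eq)

text \<open>Leading zeros are permitted above the base \<open>0\<close>, so a partition of \<open>n\<close>, having at most \<open>n\<close> parts, can be
  padded to any length \<open>l \<ge> n\<close>.\<close>

lemma card_cond_S:
  assumes "n \<le> l"
  shows "card {xs \<in> partitions_of n. cond_S k xs} = card (gap_chains k 0 l n)"
proof (rule bij_betw_same_card)
  let ?f = "\<lambda>xs::nat list. replicate (l - length xs) 0 @ rev xs"
  let ?g = "\<lambda>ys::nat list. rev (filter (\<lambda>y. y > 0) ys)"
  let ?P = "{xs \<in> partitions_of n. cond_S k xs}"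
  have succ: "successively (gap k) (0 # replicate m 0 @ ys) \<longleftrightarrow> successively (gap k) (0 # ys)" for m ys
    by (induction m) (auto simp: gap_def)
  show "bij_betw ?f ?P (gap_chains k 0 l n)"
  proof (rule bij_betw_byWitness[where f' = ?g])
    show "\<forall>xs\<in>?P. ?g (?f xs) = xs"
      by (auto simp: partitions_of_def is_partition_def rev_filter)
    have pad: "ys = replicate (l - length (?g ys)) 0 @ filter (\<lambda>y. y > 0) ys"
      if "sorted ys" "length ys = l" for ys
    proof -
      have "ys = replicate (length ys - length (filter (\<lambda>y. y > 0) ys)) 0 @ filter (\<lambda>y. y > 0) ys"
        using that(1)
      proof (induction ys)
        case (Cons y ys)
        show ?case
        proof (cases "y = 0")
          case True
          have "length (filter (\<lambda>y. y > 0) ys) \<le> length ys" by simp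
          with True Cons show ?thesis by (simp add: Suc_diff_le)
        next
          case False
          with Cons.prems have "filter (\<lambda>y. y > 0) ys = ys"
            by (auto intro!: filter_True)
          with False show ?thesis by simp
        qed
      qed simp
      with that(2) show ?thesis by simp
    qed
    show "\<forall>ys\<in>gap_chains k 0 l n. ?f (?g ys) = ys"
      using pad gap_chain_sorted unfolding gap_chains_def by fastforce
    show "?f ` ?P \<subseteq> gap_chains k 0 l n"
    proof
      fix ys assume "ys \<in> ?f ` ?P"
      then obtain xs where xs: "is_partition xs" "sum_list xs = n" "cond_S k xs" "ys = ?f xs"
        by (auto simp: partitions_of_def)
      have "length xs \<le> l"
        using length_le_sum_list[of xs] xs assms by (auto simp: is_partition_def)
      then show "ys \<in> gap_chains k 0 l n"
        using xs cond_S_iff_chain[OF xs(1)] succ by (simp add: gap_chains_def)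
    qed
    show "?g ` gap_chains k 0 l n \<subseteq> ?P"
    proof
      fix xs assume "xs \<in> ?g ` gap_chains k 0 l n"
      then obtain ys where ys: "ys \<in> gap_chains k 0 l n" "xs = ?g ys" by blast
      then have srt: "sorted ys" and eq: "ys = replicate (l - length xs) 0 @ rev xs"
        using pad[of ys] gap_chain_sorted[of k "0 # ys"] unfolding gap_chains_def by auto
      have "is_partition xs"
        using srt ys(2) by (auto simp: is_partition_def sorted_wrt_rev intro: sorted_wrt_filter)
      moreover have "sum_list xs = n"
      proof -
        have "n = sum_list (replicate (l - length xs) 0 @ rev xs)"
          using ys(1) unfolding gap_chains_def by (subst eq[symmetric]) simp
        then show ?thesis by simp
      qed
      moreover have "successively (gap k) (0 # replicate (l - length xs) 0 @ rev xs)"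
        using ys(1) unfolding gap_chains_def by (subst eq[symmetric]) simp
      ultimately show "xs \<in> ?P"
        using cond_S_iff_chain[of xs k] succ by (simp add: partitions_of_def)
    qed
  qed
qed

section \<open>Cauchy's identity and alternating weights\<close>

lemma fps_X_dvd_iff: "fps_X dvd (f :: 'a :: field fps) \<longleftrightarrow> fps_nth f 0 = 0"
proof
  assume "fps_nth f 0 = 0"
  then have "f = fps_X * fps_shift 1 f"
    by (intro fps_ext) (auto simp: fps_X_mult_nth)
  then show "fps_X dvd f" by (metis dvd_triv_left)
qed auto

text \<open>For \<open>a = A\<close> and \<open>Q = A B\<close> this is the generating function of the sequences
  \<open>i\<^sub>1 > \<dots> > i\<^sub>2\<^sub>t > 0\<close> with weight \<open>A^i\<^sub>1 B^i\<^sub>2 A^i\<^sub>3 B^i\<^sub>4 \<dots>\<close>: raising the first \<open>s\<close> entries by 1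
  multiplies the weight by \<open>W\<^sub>s\<close>, where \<open>W\<^sub>2\<^sub>j = Q^j\<close> and \<open>W\<^sub>2\<^sub>j\<^sub>+\<^sub>1 = A Q^j\<close>, and each \<open>s \<le> 2 t\<close> is used at
  least once. In closed form it is \<open>a^t Q^(t^2) / ((Q; Q)\<^sub>t (a; Q)\<^sub>t)\<close>.\<close>

primrec alt_series_even :: "'a::field fps \<Rightarrow> 'a fps \<Rightarrow> nat \<Rightarrow> 'a fps" where
  "alt_series_even Q a 0 = 1"
| "alt_series_even Q a (Suc t) =
     alt_series_even Q a t * (a * Q ^ t * inverse (1 - a * Q ^ t)) * (Q ^ Suc t * inverse (1 - Q ^ Suc t))"

text \<open>The sum over the sequences of length \<open>2 t\<close> or \<open>2 t + 1\<close>, which is the summand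
  \<open>a^t Q^(t^2) / ((Q; Q)\<^sub>t (a; Q)\<^sub>t\<^sub>+\<^sub>1)\<close> of Cauchy's identity. It also counts the multisets of natural
  numbers whose Durfee square has side \<open>t\<close>, an element \<open>m\<close> having weight \<open>a Q^m\<close>.\<close>

definition cauchy_term :: "'a::field fps \<Rightarrow> 'a fps \<Rightarrow> nat \<Rightarrow> 'a fps" where
  "cauchy_term Q a t = alt_series_even Q a t * inverse (1 - a * Q ^ t)"

lemma inverse_one_minus:
  assumes "fps_nth (f :: 'a :: field fps) 0 = 0"
  shows "inverse (1 - f) * (1 - f) = 1"
  using assms by (intro inverse_mult_eq_1) simp

lemma fps_one_minus_nz:
  assumes "fps_nth (f :: 'a :: field fps) 0 = 0"
  shows "1 - f \<noteq> 0"
  using assms by (metis diff_zero fps_one_nth fps_sub_nth fps_zero_nth one_neq_zero)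

lemma alt_series_even_eq_cauchy_term:
  assumes "fps_nth a 0 = 0"
  shows "alt_series_even Q a t = cauchy_term Q a t * (1 - a * Q ^ t)"
  using inverse_one_minus[of "a * Q ^ t"] assms
  by (simp add: cauchy_term_def mult.assoc)

lemma alt_series_even_Suc:
  assumes "fps_nth Q 0 = 0"
  shows "(1 - Q ^ Suc t) * alt_series_even Q a (Suc t) = a * Q ^ t * Q ^ Suc t * cauchy_term Q a t"
proof -
  have "(1 - Q ^ Suc t) * alt_series_even Q a (Suc t) =
      (inverse (1 - Q ^ Suc t) * (1 - Q ^ Suc t)) * (a * Q ^ t * Q ^ Suc t * cauchy_term Q a t)"
    unfolding cauchy_term_def alt_series_even.simps by (simp only: mult_ac)
  also have "inverse (1 - Q ^ Suc t) * (1 - Q ^ Suc t) = 1"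
    using assms by (intro inverse_one_minus) simp
  finally show ?thesis by simp
qed

lemma alt_series_even_shift:
  assumes "fps_nth a 0 = 0" "fps_nth Q 0 = 0"
  shows "alt_series_even Q (a * Q) t = (1 - a) * Q ^ t * cauchy_term Q a t"
proof (induction t)
  case 0
  then show ?case
    using inverse_one_minus[OF assms(1)] by (simp add: cauchy_term_def mult.commute)
next
  case (Suc t)
  define u where "u = Q ^ Suc t * inverse (1 - Q ^ Suc t)"
  have lhs: "alt_series_even Q (a * Q) (Suc t) = alt_series_even Q (a * Q) t * (a * Q ^ Suc t * inverse (1 - a * Q ^ Suc t)) * u"
    by (simp add: u_def mult.assoc)
  have rhs: "cauchy_term Q a (Suc t) = cauchy_term Q a t * (a * Q ^ t) * u * inverse (1 - a * Q ^ Suc t)"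
    by (simp add: u_def cauchy_term_def mult_ac)
  show ?case
    unfolding lhs rhs Suc.IH by (simp only: mult_ac)
qed

text \<open>Cauchy's sum satisfies \<open>(1 - a) F(a) = F(a Q)\<close>, as the product of \<open>1 / (1 - a Q^j)\<close> does, because
  the difference of the two sides telescopes. The boundary term is a multiple of \<open>Q^T\<close>.\<close>

lemma cauchy_term_telescope:
  assumes "fps_nth a 0 = 0" "fps_nth Q 0 = 0"
  shows "(1 - a) * (\<Sum>t<T. cauchy_term Q a t) =
     (\<Sum>t<T. cauchy_term Q (a * Q) t) - (1 - a) * (1 - Q ^ T) * cauchy_term Q a T"
proof (induction T)
  case (Suc T)
  define q where "q = Q ^ T"
  define x where "x = cauchy_term Q a T"
  define y where "y = cauchy_term Q a (Suc T)"
  define z where "z = cauchy_term Q (a * Q) T"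
  have "z * (1 - a * Q * q) = alt_series_even Q (a * Q) T"
    using assms by (simp add: z_def q_def alt_series_even_eq_cauchy_term[of "a * Q"])
  also have "\<dots> = (1 - a) * q * x"
    using alt_series_even_shift[OF assms] by (simp add: q_def x_def)
  finally have z: "z * (1 - a * Q * q) = (1 - a) * q * x" .
  have "y * (1 - a * Q * q) = alt_series_even Q a (Suc T)"
    unfolding alt_series_even_eq_cauchy_term[OF assms(1)] by (simp add: y_def q_def mult.assoc)
  then have y: "(1 - Q * q) * (y * (1 - a * Q * q)) = a * q * (Q * q) * x"
    using alt_series_even_Suc[OF assms(2), of T a] by (simp add: x_def q_def del: alt_series_even.simps)
  have "(1 - a * Q * q) * ((1 - a) * x) =
      (1 - a * Q * q) * (z - (1 - a) * (1 - Q * q) * y + (1 - a) * (1 - q) * x)"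
    using y z by algebra
  moreover have "1 - a * Q * q \<noteq> 0"
    using assms by (intro fps_one_minus_nz) simp
  ultimately have "(1 - a) * x = z - (1 - a) * (1 - Q * q) * y + (1 - a) * (1 - q) * x"
    by simp
  moreover define u where "u = (\<Sum>t<T. cauchy_term Q a t)"
  moreover define v where "v = (\<Sum>t<T. cauchy_term Q (a * Q) t)"
  moreover have "(1 - a) * u = v - (1 - a) * (1 - q) * x"
    using Suc.IH by (simp only: u_def v_def q_def x_def)
  ultimately have "(1 - a) * (u + x) = v + z - (1 - a) * (1 - Q * q) * y"
    by algebra
  then show ?case
    by (simp add: x_def y_def z_def q_def u_def v_def)
qed simp

lemma fps_X_power_dvd_alt_series_even:
  assumes "fps_nth Q 0 = 0"
  shows "fps_X ^ t dvd alt_series_even Q a t"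
proof (induction t)
  case (Suc t)
  have "fps_X dvd Q ^ Suc t"
    using assms by (simp add: fps_X_dvd_iff)
  with Suc.IH have "fps_X ^ t * fps_X dvd alt_series_even Q a t * Q ^ Suc t"
    by (rule mult_dvd_mono)
  moreover have "alt_series_even Q a (Suc t) = alt_series_even Q a t * Q ^ Suc t *
      (a * Q ^ t * inverse (1 - a * Q ^ t) * inverse (1 - Q ^ Suc t))"
    by (simp only: alt_series_even.simps mult_ac)
  ultimately show ?case
    by (simp only: power_Suc2 dvd_mult2)
qed simp

lemma cauchy_sum_functional:
  assumes "fps_nth a 0 = 0" "fps_nth Q 0 = 0"
  shows "fps_X ^ T dvd (1 - a) * (\<Sum>t<T. cauchy_term Q a t) - (\<Sum>t<T. cauchy_term Q (a * Q) t)"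
proof -
  have "fps_X ^ T dvd cauchy_term Q a T"
    using fps_X_power_dvd_alt_series_even[OF assms(2)] by (simp add: cauchy_term_def)
  then show ?thesis
    unfolding cauchy_term_telescope[OF assms] by simp
qed

lemma cauchy_sum_small:
  assumes "fps_nth a 0 = 0" "fps_X ^ T dvd a"
  shows "fps_X ^ T dvd (\<Sum>t<T. cauchy_term Q a t) - 1"
proof (cases T)
  case (Suc T')
  have "fps_X ^ T dvd cauchy_term Q a (Suc t)" for t
    using assms(2) by (auto simp: cauchy_term_def intro!: dvd_mult2 intro: dvd_mult dvd_mult2)
  then have "fps_X ^ T dvd (\<Sum>t<T'. cauchy_term Q a (Suc t))"
    by (intro dvd_sum) auto
  moreover have "cauchy_term Q a 0 - 1 = a * inverse (1 - a)"
    using inverse_one_minus[OF assms(1)] by (simp add: cauchy_term_def algebra_simps)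
  then have "fps_X ^ T dvd cauchy_term Q a 0 - 1"
    using assms(2) by simp
  moreover have "(\<Sum>t<T. cauchy_term Q a t) - 1 =
      (cauchy_term Q a 0 - 1) + (\<Sum>t<T'. cauchy_term Q a (Suc t))"
    unfolding Suc sum.lessThan_Suc_shift by simp
  ultimately show ?thesis by (metis dvd_add)
qed simp

text \<open>Cauchy's identity modulo \<open>X^T\<close>: iterating the functional equation \<open>T\<close> times replaces \<open>a\<close> by
  \<open>a Q^T\<close>, which is negligible.\<close>

lemma cauchy_identity_truncated:
  assumes "fps_nth a 0 = 0" "fps_nth Q 0 = 0"
  shows "fps_X ^ T dvd (\<Prod>j<T. 1 - a * Q ^ j) * (\<Sum>t<T. cauchy_term Q a t) - 1"
proof -
  let ?F = "\<lambda>a. \<Sum>t<T. cauchy_term Q a t"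
  have "fps_X ^ T dvd (\<Prod>j<J. 1 - a * Q ^ j) * ?F a - ?F (a * Q ^ J)" for J
  proof (induction J)
    case (Suc J)
    have "fps_X ^ T dvd (1 - a * Q ^ J) * ?F (a * Q ^ J) - ?F (a * Q ^ Suc J)"
      using cauchy_sum_functional[of "a * Q ^ J" Q T] assms by (simp add: mult_ac)
    moreover have "fps_X ^ T dvd (1 - a * Q ^ J) * ((\<Prod>j<J. 1 - a * Q ^ j) * ?F a - ?F (a * Q ^ J))"
      using Suc.IH by (rule dvd_mult)
    ultimately have "fps_X ^ T dvd (1 - a * Q ^ J) * ?F (a * Q ^ J) - ?F (a * Q ^ Suc J)
        + (1 - a * Q ^ J) * ((\<Prod>j<J. 1 - a * Q ^ j) * ?F a - ?F (a * Q ^ J))"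
      by (rule dvd_add)
    then show ?case by (simp add: algebra_simps)
  qed simp
  from this[of T] have "fps_X ^ T dvd (\<Prod>j<T. 1 - a * Q ^ j) * ?F a - ?F (a * Q ^ T)" .
  moreover have "fps_X ^ T dvd a * Q ^ T"
    using assms(2) by (intro dvd_mult dvd_power_same) (simp add: fps_X_dvd_iff)
  then have "fps_X ^ T dvd ?F (a * Q ^ T) - 1"
    using assms by (intro cauchy_sum_small) auto
  ultimately have "fps_X ^ T dvd ((\<Prod>j<T. 1 - a * Q ^ j) * ?F a - ?F (a * Q ^ T)) + (?F (a * Q ^ T) - 1)"
    by (rule dvd_add)
  then show ?thesis by simp
qed

text \<open>Here \<open>e n\<close> and \<open>d n\<close> are the generating functions of decreasing sequences with entries in
  \<open>{1..n}\<close> and alternating weights, starting with \<open>A\<close> and with \<open>B\<close> respectively; the recurrences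
  distinguish whether \<open>n + 1\<close> occurs. Splitting an arbitrary sequence at the threshold \<open>N\<close> gives a head with entries
  above \<open>N\<close>, of even length (\<open>p N\<close>) or odd length (\<open>r N\<close>), and a tail counted by \<open>e N\<close> or \<open>d N\<close>. Hence
  \<open>p N * e N + r N * d N\<close> does not depend on \<open>N\<close>, up to truncation. At \<open>N = 0\<close> it is Cauchy's sum, and for large \<open>N\<close> it is
  close to \<open>e N\<close>.\<close>

lemma alternating_recurrence_cauchy_sum:
  fixes A B :: "'a :: field fps" and e d :: "nat \<Rightarrow> 'a fps"
  assumes A: "fps_nth A 0 = 0" and B: "fps_nth B 0 = 0"
    and init: "e 0 = 1" "d 0 = 1"
    and e: "\<And>n. e (Suc n) = e n + A ^ Suc n * d n"
    and d: "\<And>n. d (Suc n) = d n + B ^ Suc n * e n"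
  shows "fps_X ^ T dvd e T - (\<Sum>t<T. cauchy_term (A * B) A t)"
proof -
  define Q where "Q = A * B"
  define p where "p N = (\<Sum>t<T. (Q ^ t) ^ N * alt_series_even Q A t)" for N
  define r where "r N = (\<Sum>t<T. (A * Q ^ t) ^ N * (A * Q ^ t * cauchy_term Q A t))" for N
  have Q: "fps_nth Q 0 = 0" using A by (simp add: Q_def)
  have r: "r N = r (Suc N) + A ^ Suc N * p (Suc N)" for N
  proof -
    have "(A * Q ^ t) ^ N * (A * Q ^ t * cauchy_term Q A t) =
        (A * Q ^ t) ^ Suc N * (A * Q ^ t * cauchy_term Q A t) + A ^ Suc N * ((Q ^ t) ^ Suc N * alt_series_even Q A t)" for t
    proof -
      have "(A * Q ^ t) ^ N * (A * Q ^ t * cauchy_term Q A t) =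
        (A * Q ^ t) ^ Suc N * (A * Q ^ t * cauchy_term Q A t) + (A * Q ^ t) ^ Suc N * alt_series_even Q A t"
        unfolding alt_series_even_eq_cauchy_term[OF A] by (simp add: algebra_simps)
      then show ?thesis by (simp only: power_mult_distrib mult.assoc)
    qed
    then show ?thesis
      unfolding r_def p_def sum_distrib_left sum.distrib[symmetric] by (intro sum.cong) auto
  qed
  have p: "fps_X ^ T dvd p N - (p (Suc N) + B ^ Suc N * r (Suc N))" for N
  proof -
    define g where "g t = (Q ^ t) ^ N * ((1 - Q ^ t) * alt_series_even Q A t)" for t
    have g_Suc: "g (Suc t) = B ^ Suc N * ((A * Q ^ t) ^ Suc N * (A * Q ^ t * cauchy_term Q A t))" for t
    proof -
      have "g (Suc t) = (Q ^ Suc t) ^ N * (A * Q ^ t * Q ^ Suc t * cauchy_term Q A t)"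
        unfolding g_def alt_series_even_Suc[OF Q] ..
      also have "\<dots> = (Q ^ Suc t) ^ Suc N * (A * Q ^ t * cauchy_term Q A t)"
        by (simp add: mult_ac)
      also have "Q ^ Suc t = B * (A * Q ^ t)"
        by (simp add: Q_def mult_ac)
      finally show ?thesis by (simp only: power_mult_distrib mult.assoc)
    qed
    have "p N - p (Suc N) = (\<Sum>t<T. g t)"
      unfolding p_def g_def sum_subtractf[symmetric] by (intro sum.cong) (auto simp: algebra_simps)
    also have "\<dots> = (\<Sum>t<T. g (Suc t)) - g T"
      using sum.lessThan_Suc_shift[of g T] by (simp add: g_def algebra_simps)
    also have "(\<Sum>t<T. g (Suc t)) = B ^ Suc N * r (Suc N)"
      unfolding r_def sum_distrib_left g_Suc ..
    finally have "p N - (p (Suc N) + B ^ Suc N * r (Suc N)) = - g T"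
      by (simp add: algebra_simps)
    moreover have "fps_X ^ T dvd g T"
      unfolding g_def by (intro dvd_mult fps_X_power_dvd_alt_series_even Q)
    ultimately show ?thesis by simp
  qed
  have inv: "fps_X ^ T dvd (p N * e N + r N * d N) - (p 0 * e 0 + r 0 * d 0)" for N
  proof (induction N)
    case (Suc N)
    have "(p N * e N + r N * d N) - (p (Suc N) * e (Suc N) + r (Suc N) * d (Suc N)) =
        e N * (p N - (p (Suc N) + B ^ Suc N * r (Suc N)))"
      unfolding e d r[of N] by (simp add: algebra_simps)
    moreover have "fps_X ^ T dvd e N * (p N - (p (Suc N) + B ^ Suc N * r (Suc N)))"
      using p by (rule dvd_mult)
    ultimately have "fps_X ^ T dvd ((p N * e N + r N * d N) - (p 0 * e 0 + r 0 * d 0))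
        - ((p N * e N + r N * d N) - (p (Suc N) * e (Suc N) + r (Suc N) * d (Suc N)))"
      using Suc.IH by (metis dvd_diff)
    then show ?case by (simp add: algebra_simps)
  qed simp
  have XA: "fps_X ^ T dvd A ^ T" and XQ: "fps_X ^ T dvd Q ^ T"
    using A Q by (simp_all add: dvd_power_same fps_X_dvd_iff)
  have "p 0 * e 0 + r 0 * d 0 = (\<Sum>t<T. cauchy_term Q A t)"
    unfolding init p_def r_def by (simp add: sum.distrib[symmetric] alt_series_even_eq_cauchy_term[OF A] algebra_simps)
  moreover have "fps_X ^ T dvd r T"
    unfolding r_def using XA by (intro dvd_sum dvd_mult2) (simp add: power_mult_distrib)
  moreover have "fps_X ^ T dvd p T - 1"
  proof (cases T)
    case (Suc T')
    have "fps_X ^ T dvd (Q ^ Suc t) ^ T * alt_series_even Q A (Suc t)" for t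
      using XQ by (intro dvd_mult2) (simp add: power_mult_distrib)
    then have "fps_X ^ T dvd (\<Sum>t<T'. (Q ^ Suc t) ^ T * alt_series_even Q A (Suc t))"
      by (intro dvd_sum) auto
    moreover have "p T - 1 = (\<Sum>t<T'. (Q ^ Suc t) ^ T * alt_series_even Q A (Suc t))"
      unfolding p_def by (subst Suc, subst sum.lessThan_Suc_shift) simp
    ultimately show ?thesis by simp
  qed simp
  ultimately have "fps_X ^ T dvd (p T * e T + r T * d T - (\<Sum>t<T. cauchy_term Q A t))
      - (p T - 1) * e T - r T * d T"
    using inv[of T] by (metis dvd_diff dvd_mult2)
  then show ?thesis
    unfolding Q_def[symmetric] by (simp add: algebra_simps)
qed

section \<open>Partitions with parts in a given set\<close>

text \<open>If \<open>b\<close> occurs at all, it is the first entry, and may be removed.\<close>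

lemma card_partitions_insert_max:
  assumes "finite S" "b > 0" "\<forall>a\<in>S. a < b"
  shows "card {xs \<in> partitions_of n. set xs \<subseteq> insert b S} = card {xs \<in> partitions_of n. set xs \<subseteq> S}
     + (if b \<le> n then card {xs \<in> partitions_of (n - b). set xs \<subseteq> insert b S} else 0)"
proof -
  let ?U = "\<lambda>n. {xs \<in> partitions_of n. set xs \<subseteq> insert b S}"
  let ?V = "{xs \<in> partitions_of n. set xs \<subseteq> S}"
  let ?W = "if b \<le> n then (#) b ` ?U (n - b) else {}"
  have "?U n = ?V \<union> ?W"
  proof (intro equalityI subsetI)
    fix xs assume xs: "xs \<in> ?U n"
    show "xs \<in> ?V \<union> ?W"
    proof (cases "b \<in> set xs")
      case False
      then show ?thesis using xs by auto
    next
      case True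
      then obtain y ys where y: "xs = y # ys" by (cases xs) auto
      then have "b \<le> y" "y \<in> insert b S"
        using xs True by (auto simp: partitions_of_def is_partition_def)
      then have "y = b" using assms(3) by auto
      then show ?thesis
        using xs y by (auto simp: partitions_of_def is_partition_def)
    qed
  next
    fix xs assume "xs \<in> ?V \<union> ?W"
    then consider "xs \<in> ?V" | ys where "b \<le> n" "xs = b # ys" "ys \<in> ?U (n - b)"
      by (auto split: if_splits)
    then show "xs \<in> ?U n"
    proof cases
      case 2
      have "\<forall>y\<in>insert b S. y \<le> b" using assms(3) by auto
      with 2(3) have "\<forall>y\<in>set ys. y \<le> b" by blast
      with 2 assms(2) show ?thesis
        by (simp add: partitions_of_def is_partition_def)
    qed auto
  qed
  moreover have "?V \<inter> ?W = {}"
    using assms(3) by auto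
  moreover have "finite ?V" "finite ?W"
    using finite_partitions_of by auto
  moreover have "card ?W = (if b \<le> n then card (?U (n - b)) else 0)"
    by (auto simp: card_image)
  ultimately show ?thesis
    by (simp only: card_Un_disjoint)
qed

lemma fps_partitions_into:
  assumes "finite S" "\<forall>m\<in>S. m > 0"
  shows "(Abs_fps (\<lambda>n. of_nat (card {xs \<in> partitions_of n. set xs \<subseteq> S})) :: 'a :: field fps) =
    (\<Prod>m\<in>S. inverse (1 - fps_X ^ m))"
  using assms
proof (induction S rule: finite_linorder_max_induct)
  case empty
  have "{xs \<in> partitions_of n. set xs \<subseteq> {}} = (if n = 0 then {[]} else {})" for n
    by (auto simp: partitions_of_def is_partition_def)
  then show ?case
    by (intro fps_ext) simp
next
  case (insert b S)
  define g where "g S = (Abs_fps (\<lambda>n. of_nat (card {xs \<in> partitions_of n. set xs \<subseteq> S})) :: 'a fps)" for S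
  have "g (insert b S) = g S + fps_X ^ b * g (insert b S)"
    using insert.prems insert.hyps
    by (intro fps_ext) (auto simp: g_def fps_X_power_mult_nth card_partitions_insert_max)
  then have "(1 - fps_X ^ b) * g (insert b S) = g S"
    by (simp add: algebra_simps)
  then have "(inverse (1 - fps_X ^ b) * (1 - fps_X ^ b)) * g (insert b S) = inverse (1 - fps_X ^ b) * g S"
    by (simp only: mult.assoc)
  moreover have "inverse (1 - fps_X ^ b) * (1 - fps_X ^ b) = (1 :: 'a fps)"
    using insert.prems by (intro inverse_one_minus) simp
  ultimately have "g (insert b S) = inverse (1 - fps_X ^ b) * g S"
    by simp
  moreover have "g S = (\<Prod>m\<in>S. inverse (1 - fps_X ^ m))"
    unfolding g_def using insert.prems by (intro insert.IH) simp
  moreover have "b \<notin> S"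
    using insert.hyps(2) by blast
  ultimately show ?case
    using insert.hyps(1) by (simp add: g_def)
qed

text \<open>Parts exceeding \<open>n\<close> cannot occur, so any finite set of allowed parts containing those up to \<open>n\<close> yields
  the right coefficient. This freedom is used with two different choices of \<open>S\<close>.\<close>

lemma card_cond_P:
  assumes "finite S" "\<forall>m\<in>S. m > 0 \<and> allowed_part k m"
    "\<And>m. m > 0 \<Longrightarrow> m \<le> n \<Longrightarrow> allowed_part k m \<Longrightarrow> m \<in> S"
  shows "(of_nat (card {xs \<in> partitions_of n. cond_P k xs}) :: 'a :: field) =
    fps_nth (\<Prod>m\<in>S. inverse (1 - fps_X ^ m)) n"
proof -
  have "cond_P k xs \<longleftrightarrow> set xs \<subseteq> S" if "xs \<in> partitions_of n" for xs
  proof -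
    have "x > 0 \<and> x \<le> n" if "x \<in> set xs" for x
      using that \<open>xs \<in> partitions_of n\<close> member_le_sum_list[of x xs]
      by (auto simp: partitions_of_def is_partition_def)
    then show ?thesis
      using assms(2,3) by (auto simp: cond_P_def)
  qed
  then have "{xs \<in> partitions_of n. cond_P k xs} = {xs \<in> partitions_of n. set xs \<subseteq> S}"
    by auto
  then have "(of_nat (card {xs \<in> partitions_of n. cond_P k xs}) :: 'a) =
      fps_nth (Abs_fps (\<lambda>n. of_nat (card {xs \<in> partitions_of n. set xs \<subseteq> S}))) n"
    by simp
  then show ?thesis
    by (subst (asm) fps_partitions_into) (use assms in auto)
qed

lemma has_prod_cond_P:
  "(\<lambda>m. if m \<ge> 1 \<and> allowed_part k m then inverse (1 - fps_X ^ m) else 1)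
    has_prod (Abs_fps (\<lambda>n. of_nat (card {xs \<in> partitions_of n. cond_P k xs})) :: rat fps)"
  (is "?f has_prod ?g")
proof -
  define S where "S N = {m \<in> {..N}. m \<ge> 1 \<and> allowed_part k m}" for N
  have "(\<Prod>m\<le>N. ?f m) = (\<Prod>m\<in>S N. inverse (1 - fps_X ^ m))" for N
    unfolding S_def by (rule prod.inter_filter[symmetric]) simp
  moreover have "fps_nth ?g n = fps_nth (\<Prod>m\<in>S N. inverse (1 - fps_X ^ m)) n" if "n \<le> N" for n N
    unfolding fps_nth_Abs_fps by (rule card_cond_P) (use that in \<open>auto simp: S_def\<close>)
  ultimately have eq: "fps_nth (\<Prod>m\<le>N. ?f m) n = fps_nth ?g n" if "n \<le> N" for n N
    using that by simp
  have "(\<lambda>N. \<Prod>m\<le>N. ?f m) \<longlonglongrightarrow> ?g"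
  proof (rule tendsto_fpsI)
    fix n
    show "\<forall>\<^sub>F N in sequentially. fps_nth (\<Prod>m\<le>N. ?f m) n = fps_nth ?g n"
      using eventually_ge_at_top[of n] by eventually_elim (rule eq)
  qed
  moreover have "?g \<noteq> 0"
  proof
    assume "?g = 0"
    then have "fps_nth ?g 0 = 0" by simp
    moreover have "fps_nth ?g 0 = 1"
      using eq[of 0 0] by simp
    ultimately show False by simp
  qed
  ultimately show ?thesis
    unfolding has_prod_def raw_has_prod_def add_0_right by blast
qed

section \<open>Equality of the two counts\<close>

definition gap_chain_fps :: "nat \<Rightarrow> nat \<Rightarrow> nat \<Rightarrow> 'a::field fps" where
  "gap_chain_fps k b l = Abs_fps (\<lambda>w. of_nat (card (gap_chains k b l w)))"

lemma gap_chain_fps_Suc: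
  "(1 - fps_X ^ (2 * Suc l)) * gap_chain_fps k b (Suc l) =
     gap_chain_fps k b l + (fps_X ^ odd_gap k b) ^ Suc l * gap_chain_fps k (Suc b) l"
proof -
  have "gap_chain_fps k b (Suc l) = gap_chain_fps k b l
      + fps_X ^ (odd_gap k b * Suc l) * gap_chain_fps k (Suc b) l
      + fps_X ^ (2 * Suc l) * (gap_chain_fps k b (Suc l) :: 'a fps)"
    by (intro fps_ext, subst gap_chain_fps_def)
      (simp add: gap_chain_fps_def fps_X_power_mult_nth card_gap_chains_Suc[of k b l] not_less del: mult_Suc_right)
  then show ?thesis
    unfolding power_mult[symmetric] left_diff_distrib mult_1 by (simp only: diff_eq_eq)
qed

text \<open>Multiplied by the product of \<open>1 - X^(2 i)\<close>, the chains above an even and an odd base obey the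
  alternating recurrence with \<open>A = X^3\<close> and \<open>B = X^(2 k + 3)\<close>; Cauchy's identity then supplies the
  parts \<open>3 + (2 k + 6) j\<close>.\<close>

lemma gap_chain_fps_approx:
  "fps_X ^ l dvd (\<Prod>i=1..l. 1 - fps_X ^ (2 * i)) * (\<Prod>j<l. 1 - fps_X ^ (3 + (2 * k + 6) * j))
      * gap_chain_fps k 0 l - (1 :: 'a :: field fps)"
proof -
  define A B :: "'a fps" where "A = fps_X ^ 3" and "B = fps_X ^ (2 * k + 3)"
  define E where "E b n = (\<Prod>i=1..n. 1 - fps_X ^ (2 * i)) * (gap_chain_fps k b n :: 'a fps)" for b n
  have E_Suc: "E b (Suc n) = E b n + (fps_X ^ odd_gap k b) ^ Suc n * E (Suc b) n" for b n
  proof -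
    have "E b (Suc n) = (\<Prod>i=1..n. 1 - fps_X ^ (2 * i)) *
        ((1 - fps_X ^ (2 * Suc n)) * gap_chain_fps k b (Suc n))"
      by (simp add: E_def mult_ac)
    then show ?thesis
      unfolding gap_chain_fps_Suc by (simp add: E_def algebra_simps)
  qed
  have "gap_chain_fps k 2 n = (gap_chain_fps k 0 n :: 'a fps)" for n
    unfolding gap_chain_fps_def using card_gap_chains_cong_parity[of 2 0] by simp
  then have E2: "E 2 n = E 0 n" for n
    by (simp add: E_def)
  have "gap_chain_fps k b 0 = (1 :: 'a fps)" for b
    unfolding gap_chain_fps_def by (intro fps_ext) (simp add: gap_chains_0)
  then have E_0: "E b 0 = 1" for b
    by (simp add: E_def)
  have 1: "fps_X ^ l dvd E 0 l - (\<Sum>t<l. cauchy_term (A * B) A t)"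
  proof (rule alternating_recurrence_cauchy_sum[where d = "E 1"])
    show "E 0 (Suc n) = E 0 n + A ^ Suc n * E 1 n" for n
      unfolding E_Suc A_def by (simp add: odd_gap_def)
    show "E 1 (Suc n) = E 1 n + B ^ Suc n * E 0 n" for n
      using E_Suc[of 1 n, unfolded Suc_1 E2] by (simp add: B_def odd_gap_def)
  qed (simp_all add: A_def B_def E_0)
  define D where "D = (\<Prod>j<l. 1 - A * (A * B) ^ j)"
  have D: "D = (\<Prod>j<l. 1 - fps_X ^ (3 + (2 * k + 6) * j))"
    unfolding D_def A_def B_def by (simp add: add.commute flip: power_add power_mult)
  have "fps_X ^ l dvd D * (\<Sum>t<l. cauchy_term (A * B) A t) - 1"
    unfolding D_def by (rule cauchy_identity_truncated) (simp_all add: A_def)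
  then have "fps_X ^ l dvd D * (E 0 l - (\<Sum>t<l. cauchy_term (A * B) A t))
      + (D * (\<Sum>t<l. cauchy_term (A * B) A t) - 1)"
    using 1 by (intro dvd_add dvd_mult)
  then show ?thesis
    unfolding D[symmetric] E_def by (simp add: algebra_simps)
qed

lemma allowed_part_iff:
  "m > 0 \<and> allowed_part k m \<longleftrightarrow> (\<exists>i\<ge>1. m = 2 * i) \<or> (\<exists>j. m = 3 + (2 * k + 6) * j)"
proof -
  have "[m = 3] (mod (2 * k + 6)) \<longleftrightarrow> (\<exists>j. m = 3 + (2 * k + 6) * j)"
  proof
    assume "[m = 3] (mod (2 * k + 6))"
    then have "m mod (2 * k + 6) = 3" by (simp add: cong_def)
    then show "\<exists>j. m = 3 + (2 * k + 6) * j"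
      by (metis add.commute mult_div_mod_eq)
  next
    assume "\<exists>j. m = 3 + (2 * k + 6) * j"
    then obtain j where "m = 3 + (2 * k + 6) * j" ..
    then show "[m = 3] (mod (2 * k + 6))" by (simp add: cong_def)
  qed
  then show ?thesis
    unfolding allowed_part_def by (auto elim!: evenE)
qed

lemma card_cond_P_eq_card_cond_S:
  "card {xs \<in> partitions_of n. cond_P k xs} = card {xs \<in> partitions_of n. cond_S k xs}"
proof -
  define l where "l = Suc n"
  define V where "V = (\<lambda>i. 2 * i) ` {1..l}"
  define W where "W = (\<lambda>j. 3 + (2 * k + 6) * j) ` {..<l}"
  define D :: "rat fps" where
    "D = (\<Prod>i=1..l. 1 - fps_X ^ (2 * i)) * (\<Prod>j<l. 1 - fps_X ^ (3 + (2 * k + 6) * j))"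
  have "even v" if "v \<in> V" for v using that by (auto simp: V_def)
  moreover have "odd v" if "v \<in> W" for v using that by (auto simp: W_def)
  ultimately have disj: "V \<inter> W = {}" by blast
  have "(\<Prod>m\<in>V \<union> W. 1 - fps_X ^ m) = D"
  proof -
    have "(\<Prod>m\<in>V. 1 - fps_X ^ m :: rat fps) = (\<Prod>i=1..l. 1 - fps_X ^ (2 * i))"
      unfolding V_def by (subst prod.reindex) (auto simp: inj_on_def)
    moreover have "(\<Prod>m\<in>W. 1 - fps_X ^ m :: rat fps) = (\<Prod>j<l. 1 - fps_X ^ (3 + (2 * k + 6) * j))"
      unfolding W_def by (subst prod.reindex) (auto simp: inj_on_def)
    moreover have "(\<Prod>m\<in>V \<union> W. 1 - fps_X ^ m :: rat fps) =
        (\<Prod>m\<in>V. 1 - fps_X ^ m) * (\<Prod>m\<in>W. 1 - fps_X ^ m)"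
      using disj by (intro prod.union_disjoint) (simp_all add: V_def W_def)
    ultimately show ?thesis
      unfolding D_def by (simp only:)
  qed
  moreover have allowed: "m > 0 \<and> allowed_part k m" if "m \<in> V \<union> W" for m
    using that unfolding allowed_part_iff V_def W_def by auto
  have "(\<Prod>m\<in>V \<union> W. inverse (1 - fps_X ^ m)) * (\<Prod>m\<in>V \<union> W. 1 - fps_X ^ m) = (1 :: rat fps)"
    unfolding prod.distrib[symmetric] using allowed by (intro prod.neutral ballI inverse_one_minus) auto
  ultimately have inv: "(\<Prod>m\<in>V \<union> W. inverse (1 - fps_X ^ m)) * D = 1"
    by simp
  have complete: "m \<in> V \<union> W" if m: "m > 0" "m \<le> n" "allowed_part k m" for m
  proof -
    from m have "(\<exists>i\<ge>1. m = 2 * i) \<or> (\<exists>j. m = 3 + (2 * k + 6) * j)"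
      using allowed_part_iff by blast
    then show ?thesis
    proof (elim disjE exE conjE)
      fix i assume "i \<ge> 1" "m = 2 * i"
      then show ?thesis using m(2) by (auto simp: V_def l_def)
    next
      fix j assume j: "m = 3 + (2 * k + 6) * j"
      have "1 * j \<le> (2 * k + 6) * j" by (rule mult_le_mono1) simp
      then have "j < l" using j m(2) unfolding l_def by linarith
      then show ?thesis using j by (auto simp: W_def)
    qed
  qed
  have "(of_nat (card {xs \<in> partitions_of n. cond_P k xs}) :: rat) =
      fps_nth (\<Prod>m\<in>V \<union> W. inverse (1 - fps_X ^ m)) n"
  proof (rule card_cond_P)
    show "finite (V \<union> W)" by (simp add: V_def W_def)
    show "\<forall>m\<in>V \<union> W. m > 0 \<and> allowed_part k m" using allowed by blast
  qed (fact complete)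
  moreover have "(of_nat (card {xs \<in> partitions_of n. cond_S k xs}) :: rat) = fps_nth (gap_chain_fps k 0 l) n"
    by (simp add: card_cond_S[of n l] l_def gap_chain_fps_def)
  moreover have "fps_nth (gap_chain_fps k 0 l) n = fps_nth (\<Prod>m\<in>V \<union> W. inverse (1 - fps_X ^ m) :: rat fps) n"
  proof -
    obtain h where h: "D * gap_chain_fps k 0 l - 1 = fps_X ^ l * h"
      using gap_chain_fps_approx[of l k] unfolding D_def by (elim dvdE)
    define G where "G = (\<Prod>m\<in>V \<union> W. inverse (1 - fps_X ^ m) :: rat fps)"
    have "gap_chain_fps k 0 l = (G * D) * gap_chain_fps k 0 l"
      using inv by (simp add: G_def)
    also have "\<dots> = G * (1 + fps_X ^ l * h)"
      using h by (simp only: mult.assoc diff_eq_eq add.commute)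
    also have "\<dots> = G + fps_X ^ l * (h * G)"
      by (simp add: algebra_simps)
    finally show ?thesis
      unfolding G_def[symmetric]
      by (simp add: fps_X_power_mult_nth l_def del: power_Suc)
  qed
  ultimately have "(of_nat (card {xs \<in> partitions_of n. cond_P k xs}) :: rat) =
      of_nat (card {xs \<in> partitions_of n. cond_S k xs})"
    by (simp only:)
  then show ?thesis
    by (simp only: of_nat_eq_iff)
qed

theorem mainTheorem6:
  fixes k :: nat
  assumes "k \<ge> 1"
  shows "(\<forall>n. card {xs \<in> partitions_of n. cond_P k xs} = card {xs \<in> partitions_of n. cond_S k xs})
    \<and> (\<lambda>m. if m \<ge> 1 \<and> allowed_part k m then inverse (1 - fps_X ^ m) else 1)
        has_prod (Abs_fps (\<lambda>n. of_nat (card {xs \<in> partitions_of n. cond_P k xs})) :: rat fps)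
    \<and> (\<forall>xs. is_partition xs \<longrightarrow> (cond_S k xs \<longleftrightarrow> cond_C k (conjugate xs)))"
proof (intro conjI allI impI)
  show "card {xs \<in> partitions_of n. cond_P k xs} = card {xs \<in> partitions_of n. cond_S k xs}" for n
    by (rule card_cond_P_eq_card_cond_S)
qed (rule has_prod_cond_P, simp only: cond_S_iff_gaps cond_C_conjugate_iff_gaps)

end
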